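(* Let $m$ be a positive integer divisible by $6$ and let $i$ be a positive integer with $\gcd(m,i)=1$. Define $F':\mathbb{F}_{2^m}\to\mathbb{F}_{2^m}$ by $$F'(x)=\Big[x+tr_{m/3}\big(x^{2(2^i+1)}+x^{4(2^i+1)}\big)+tr(x)\,tr_{m/3}\big(x^{2^i+1}+x^{2^{2i}(2^i+1)}\big)\Big]^{2^i+1}.$$ Then $F'$ is almost perfect nonlinear (APN).
   Context: $tr(x)=x+x^2+\dots+x^{2^{m-1}}$ is the absolute trace from $\mathbb{F}_{2^m}$ to $\mathbb{F}_2$, and for $3\mid m$, $tr_{m/3}(x)=x+x^{2^3}+x^{2^6}+\dots+x^{2^{m-3}}$ is the relative trace from $\mathbb{F}_{2^m}$ to $\mathbb{F}_{2^3}$. A function $F:\mathbb{F}_{2^m}\to\mathbb{F}_{2^m}$ is almost perfect nonlinear (APN) if for every $a\neq 0$ and every $b$ in $\mathbb{F}_{2^m}$ the equation $F(x+a)+F(x)=b$ has at most $2$ solutions $x\in\mathbb{F}_{2^m}$. *)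

theory Defs
  imports "HOL-Library.Cardinality"
begin

text \<open>
  The field with $2^m$ elements is rendered as an arbitrary type \<open>'a\<close> of the classes \<open>field\<close> and
  \<open>finite\<close> with \<open>CARD('a) = 2 ^ m\<close>. The subfields with $2$ and $8$ elements are not
  separate types: the traces below take values in the ambient field.
\<close>

definition abs_trace :: "nat \<Rightarrow> 'a::field \<Rightarrow> 'a"
  where "abs_trace m x = (\<Sum>k<m. x ^ (2 ^ k))"

text \<open>Relative trace to the subfield with $8$ elements; only meaningful for \<open>3 dvd m\<close>.\<close>

definition rel_trace3 :: "nat \<Rightarrow> 'a::field \<Rightarrow> 'a"
  where "rel_trace3 m x = (\<Sum>k<m div 3. x ^ (2 ^ (3 * k)))"

definition APN :: "('a::{field,finite} \<Rightarrow> 'a) \<Rightarrow> bool"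
  where "APN F \<longleftrightarrow> (\<forall>a b. a \<noteq> 0 \<longrightarrow> card {x. F (x + a) + F x = b} \<le> 2)"

definition F' :: "nat \<Rightarrow> nat \<Rightarrow> 'a::field \<Rightarrow> 'a"
  where "F' m i x =
    (x + rel_trace3 m (x ^ (2 * (2 ^ i + 1)) + x ^ (4 * (2 ^ i + 1)))
       + abs_trace m x * rel_trace3 m (x ^ (2 ^ i + 1) + x ^ (2 ^ (2 * i) * (2 ^ i + 1))))
    ^ (2 ^ i + 1)"

end

theory Submission
  imports Defs
begin

text \<open>
  Write \<open>F x = x ^ (2 ^ i + 1)\<close> and let \<open>t\<close> be the relative trace onto the field with $8$ elements.
  Then \<open>F' = F \<circ> G\<close>, where \<open>G\<close> is the inverse of \<open>x \<mapsto> x + t (F x ^ 2 + F x ^ 4)\<close>. Hence the graph of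
  \<open>F'\<close> is the image of the graph of the Gold function \<open>F\<close> under the linear involution
  \<open>(x, y) \<mapsto> (x + t (y ^ 2 + y ^ 4), y)\<close>, and such maps preserve the APN property. That \<open>G\<close> is the
  inverse reduces, as \<open>G x - x\<close> lies in the field with $8$ elements, to a polynomial identity
  there, with one case for each nonzero residue of \<open>i\<close> modulo \<open>3\<close>.
\<close>

section \<open>Finite fields of characteristic two\<close>

text \<open>Translation by 1 permutes the field, so adding 1 to every element leaves the sum of all
  elements unchanged.\<close>

lemma of_nat_card_eq_0: "of_nat CARD('a) = (0 :: 'a::{field,finite})"
proof -
  have "(\<Sum>y\<in>UNIV. y + 1) = (\<Sum>y\<in>UNIV. y :: 'a)"
    by (rule sum.reindex_bij_betw[of "\<lambda>y. y + 1" UNIV UNIV "\<lambda>y. y"])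
       (rule bij_betw_byWitness[where f' = "\<lambda>y. y - 1"]; simp)
  then show ?thesis
    by (simp add: sum.distrib)
qed

text \<open>Multiplication by a nonzero \<open>x\<close> permutes the nonzero elements; compare
  their product before and after.\<close>

lemma power_card_eq_self: "x ^ CARD('a) = (x :: 'a::{field,finite})"
proof (cases "x = 0")
  case False
  let ?P = "\<Prod>y\<in>-{0}. y :: 'a"
  have "(\<Prod>y\<in>-{0}. x * y) = ?P"
    by (rule prod.reindex_bij_betw[of "\<lambda>y. x * y" "-{0}" "-{0}" "\<lambda>y. y"])
       (rule bij_betw_byWitness[where f' = "\<lambda>y. y / x"]; use False in auto)
  then have "x ^ card (-{0 :: 'a}) * ?P = ?P"
    by (simp add: prod.distrib)
  moreover have "?P \<noteq> 0"
    by simp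
  ultimately have "x ^ card (-{0 :: 'a}) = 1"
    by simp
  moreover have "CARD('a) = Suc (card (-{0 :: 'a}))"
    unfolding Compl_eq_Diff_UNIV by (rule card.remove) auto
  ultimately show ?thesis
    by simp
qed (simp add: card_gt_0_iff)

lemma two_eq_0:
  assumes "CARD('a::{field,finite}) = 2 ^ m"
  shows "(2 :: 'a) = 0"
  using of_nat_card_eq_0[where 'a = 'a] assms by simp

lemma add_self:
  fixes x :: "'a::comm_ring_1"
  assumes "(2 :: 'a) = 0"
  shows "x + x = 0"
  using assms by (metis mult_2 mult_zero_left)

lemma add_cancel_left:
  fixes x :: "'a::comm_ring_1"
  assumes "(2 :: 'a) = 0"
  shows "x + (x + y) = y"
  using add_self[OF assms] by (metis add.assoc add_0)

lemma eq_if_add_eq_0: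
  fixes x :: "'a::comm_ring_1"
  assumes "(2 :: 'a) = 0" and "x + y = 0"
  shows "x = y"
  using add_self[OF assms(1), of y] assms(2) by (metis add_right_cancel)

lemma square_add:
  fixes x y :: "'a::comm_ring_1"
  assumes "(2 :: 'a) = 0"
  shows "(x + y) ^ 2 = x ^ 2 + y ^ 2"
  using assms by (simp add: power2_sum)

lemma frobenius_add:
  fixes x y :: "'a::comm_ring_1"
  assumes "(2 :: 'a) = 0"
  shows "(x + y) ^ 2 ^ k = x ^ 2 ^ k + y ^ 2 ^ k"
  by (induction k) (simp_all add: power_Suc2 power_mult square_add[OF assms] del: power_Suc)

lemma frobenius_sum:
  fixes f :: "'b \<Rightarrow> 'a::comm_ring_1"
  assumes "(2 :: 'a) = 0"
  shows "(\<Sum>x\<in>A. f x) ^ 2 ^ k = (\<Sum>x\<in>A. f x ^ 2 ^ k)"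
  by (induction A rule: infinite_finite_induct) (simp_all add: frobenius_add[OF assms] zero_power)

lemma frobenius_iterate_fixed:
  fixes x :: "'a::monoid_mult"
  assumes "x ^ 2 ^ k = x"
  shows "x ^ 2 ^ (k * n) = x"
  by (induction n) (simp_all add: power_add power_mult assms)

text \<open>By Bezout some iterate of the \<open>i\<close>-th Frobenius power is, up to iterates of
  the \<open>m\<close>-th, squaring itself; hence \<open>z = z ^ 2\<close>.\<close>

lemma frobenius_coprime_fixed:
  fixes z :: "'a::field"
  assumes "gcd m i = 1" and "i > 0" and "z ^ 2 ^ m = z" and "z ^ 2 ^ i = z"
  shows "z = 0 \<or> z = 1"
proof -
  obtain a b where ab: "i * a = m * b + 1"
    using bezout_nat[of i m] assms(1,2) by (auto simp: gcd.commute)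
  have "z = z ^ 2 ^ (m * b + 1)"
    using frobenius_iterate_fixed[OF assms(4), of a] ab by simp
  also have "\<dots> = (z ^ 2 ^ (m * b)) ^ 2"
    by (simp add: power_mult [symmetric] mult.commute)
  also have "\<dots> = z ^ 2"
    by (simp add: frobenius_iterate_fixed[OF assms(3)])
  finally show ?thesis
    by (auto simp: power2_eq_square)
qed

section \<open>The Gold function\<close>

lemma gold_add:
  fixes x y :: "'a::comm_ring_1"
  assumes "(2 :: 'a) = 0"
  shows "(x + y) ^ (2 ^ i + 1) =
    x ^ (2 ^ i + 1) + x ^ 2 ^ i * y + x * y ^ 2 ^ i + y ^ (2 ^ i + 1)"
  by (simp add: frobenius_add[OF assms] algebra_simps)

text \<open>The derivative of the Gold function is affine over the field with 2 elements, and
  \<open>(u + v) / a\<close> turns its kernel condition into \<open>z ^ 2 ^ i = z\<close>.\<close>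

lemma gold_APN:
  fixes a u v :: "'a::{field,finite}"
  assumes "gcd m i = 1" and "i > 0" and card: "CARD('a) = 2 ^ m" and "a \<noteq> 0"
    and "u ^ (2 ^ i + 1) + (u + a) ^ (2 ^ i + 1) = v ^ (2 ^ i + 1) + (v + a) ^ (2 ^ i + 1)"
  shows "v = u \<or> v = u + a"
proof -
  note two = two_eq_0[OF card]
  define z where "z = (u + v) / a"
  have v: "v = u + z * a"
    using \<open>a \<noteq> 0\<close> by (simp add: z_def add_cancel_left[OF two])
  have "u ^ 2 ^ i * a + u * a ^ 2 ^ i = v ^ 2 ^ i * a + v * a ^ 2 ^ i"
    using assms(5) unfolding gold_add[OF two] add.assoc add_cancel_left[OF two]
    by (simp flip: add.assoc)
  then have "(z * a) ^ 2 ^ i * a + z * a * a ^ 2 ^ i = 0"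
    by (simp add: v frobenius_add[OF two] algebra_simps)
  then have "z ^ 2 ^ i * (a * a ^ 2 ^ i) + z * (a * a ^ 2 ^ i) = 0"
    by (simp add: power_mult_distrib mult_ac)
  from eq_if_add_eq_0[OF two this] have "z ^ 2 ^ i = z"
    using \<open>a \<noteq> 0\<close> by simp
  moreover have "z ^ 2 ^ m = z"
    using power_card_eq_self[of z] card by simp
  ultimately have "z = 0 \<or> z = 1"
    by (intro frobenius_coprime_fixed[OF assms(1,2)])
  then show ?thesis
    using v by auto
qed

section \<open>The relative trace\<close>

lemma rel_trace3_add:
  fixes x y :: "'a::field"
  assumes "(2 :: 'a) = 0"
  shows "rel_trace3 m (x + y) = rel_trace3 m x + rel_trace3 m y"
  by (simp add: rel_trace3_def frobenius_add[OF assms] sum.distrib)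

lemma rel_trace3_frobenius:
  fixes x :: "'a::field"
  assumes "(2 :: 'a) = 0"
  shows "rel_trace3 m (x ^ 2 ^ k) = rel_trace3 m x ^ 2 ^ k"
  by (simp add: rel_trace3_def frobenius_sum[OF assms] power_mult [symmetric] mult.commute)

text \<open>Elements of the subfield with 8 elements are fixed by every power of the cubed
  Frobenius, so they factor out of each summand.\<close>

lemma rel_trace3_mult:
  fixes c x :: "'a::field"
  assumes "c ^ 8 = c"
  shows "rel_trace3 m (c * x) = c * rel_trace3 m x"
proof -
  have "c ^ 2 ^ (3 * k) = c" for k
    by (rule frobenius_iterate_fixed) (simp add: assms)
  then show ?thesis
    by (simp add: rel_trace3_def power_mult_distrib sum_distrib_left)
qed

text \<open>The eighth power shifts the summands cyclically; the last one wraps around to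
  \<open>x\<close>.\<close>

lemma rel_trace3_power_8:
  fixes x :: "'a::field"
  assumes "(2 :: 'a) = 0" and "3 dvd m" and "x ^ 2 ^ m = x"
  shows "rel_trace3 m x ^ 8 = rel_trace3 m x"
proof -
  obtain n where m: "m = 3 * n"
    using assms(2) by blast
  define g where "g k = x ^ 2 ^ (3 * k)" for k
  have g: "g k ^ 8 = g (Suc k)" for k
    by (simp add: g_def power_mult [symmetric] power_add mult.commute)
  have "rel_trace3 m x ^ 2 ^ 3 = (\<Sum>k<n. g (Suc k))"
    unfolding rel_trace3_def frobenius_sum[OF assms(1)] using g by (simp add: m g_def)
  moreover have "(\<Sum>k<n. g (Suc k)) = (\<Sum>k<n. g k)"
    using sum.lessThan_Suc_shift[of g n] sum.lessThan_Suc[of g n] assms(3)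
    by (simp add: g_def m add.commute)
  ultimately show ?thesis
    by (simp add: rel_trace3_def g_def m)
qed

text \<open>The trace has \<open>m div 3\<close> summands, an even number as \<open>6 dvd m\<close>,
  so the trace of 1 vanishes; linearity over the subfield does the rest.\<close>

lemma rel_trace3_fixed:
  fixes c :: "'a::field"
  assumes "(2 :: 'a) = 0" and "6 dvd m" and "c ^ 8 = c"
  shows "rel_trace3 m c = 0"
proof -
  obtain n where m: "m = 6 * n"
    using assms(2) by blast
  have "rel_trace3 m 1 = (0 :: 'a)"
    using assms(1) by (simp add: rel_trace3_def m)
  then show ?thesis
    using rel_trace3_mult[OF assms(3), of m 1] by simp
qed

text \<open>Transitivity of the trace: the exponents are grouped into residues modulo 3.\<close>

lemma abs_trace_eq_rel_trace3:
  fixes x :: "'a::field"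
  assumes "(2 :: 'a) = 0" and "3 dvd m"
  shows "abs_trace m x = rel_trace3 m x + rel_trace3 m x ^ 2 + rel_trace3 m x ^ 4"
proof -
  obtain n where m: "m = n * 3"
    using assms(2) by (metis dvd_def mult.commute)
  have "abs_trace (n * 3) x = (\<Sum>k<n. x ^ 2 ^ (3 * k) + (x ^ 2 ^ (3 * k)) ^ 2 + (x ^ 2 ^ (3 * k)) ^ 4)"
    by (induction n)
       (simp_all add: abs_trace_def power_mult [symmetric] ac_simps numeral_3_eq_3)
  then show ?thesis
    by (simp add: rel_trace3_def m sum.distrib
        frobenius_sum[OF assms(1), of _ _ 1, simplified] frobenius_sum[OF assms(1), of _ _ 2, simplified])
qed

section \<open>The inverse of the permutation underlying the graph transformation\<close>

text \<open>Frobenius has order dividing 3 on the subfield with 8 elements, so only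
  \<open>i mod 3\<close> matters.\<close>

lemma frobenius_cases_8:
  fixes i :: nat
  assumes "\<not> 3 dvd i"
  obtains "\<And>x :: 'a::field. x ^ 8 = x \<Longrightarrow> x ^ 2 ^ i = x ^ 2"
    | "\<And>x :: 'a. x ^ 8 = x \<Longrightarrow> x ^ 2 ^ i = x ^ 4"
proof -
  have *: "x ^ 2 ^ i = x ^ 2 ^ (i mod 3)" if "x ^ 8 = x" for x :: 'a
  proof -
    have "x ^ 2 ^ (3 * (i div 3)) = x"
      by (rule frobenius_iterate_fixed) (simp add: that)
    moreover have "x ^ 2 ^ i = (x ^ 2 ^ (3 * (i div 3))) ^ 2 ^ (i mod 3)"
      by (simp flip: power_mult power_add)
    ultimately show ?thesis
      by simp
  qed
  have "i mod 3 = 1 \<or> i mod 3 = 2"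
    using assms by presburger
  then show ?thesis
    using that * by auto
qed

text \<open>The arguments \<open>f\<close> and \<open>s\<close> stand for the relative traces of \<open>F x\<close> and of \<open>x\<close>, and
  \<open>h\<close> for the difference \<open>G x - x\<close>.\<close>

lemma inverse_identity_8:
  fixes f s :: "'a::field"
  assumes two: "(2 :: 'a) = 0" and f: "f ^ 8 = f" and s: "s ^ 8 = s" and "\<not> 3 dvd i"
  defines "h \<equiv> f ^ 2 + f ^ 4 + (s + s ^ 2 + s ^ 4) * (f + f ^ 2 ^ (2 * i))"
  shows "h ^ 8 = h"
    and "(f + (s ^ 2 ^ i * h + s * h ^ 2 ^ i)) ^ 2 + (f + (s ^ 2 ^ i * h + s * h ^ 2 ^ i)) ^ 4 = h"
proof -
  have p2: "(x + y) ^ 2 = x ^ 2 + y ^ 2" and p4: "(x + y) ^ 4 = x ^ 4 + y ^ 4"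
    and p8: "(x + y) ^ 8 = x ^ 8 + y ^ 8" for x y :: 'a
    using frobenius_add[OF two, of x y 1] frobenius_add[OF two, of x y 2]
      frobenius_add[OF two, of x y 3] by simp_all
  have f16: "f ^ 16 = f ^ 2" and s16: "s ^ 16 = s ^ 2" and f32: "f ^ 32 = f ^ 4"
    using power_mult[of f 8 2] power_mult[of s 8 2] power_mult[of f 8 4] f s by simp_all
  note char2 = add_self[OF two] add_cancel_left[OF two]
  note simps = p2 p4 p8 f s f16 s16 f32 char2 power_mult_distrib power_mult [symmetric] ac_simps
  \<comment> \<open>\<open>T\<close> is the trace of \<open>s\<close> from the field with 8 elements
    to the field with 2, hence 0 or 1.\<close>
  define T where "T = s + s ^ 2 + s ^ 4"
  have h_def: "h = f ^ 2 + f ^ 4 + T * (f + f ^ 2 ^ (2 * i))"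
    by (simp add: h_def T_def)
  have "T ^ 2 = T"
    by (simp add: T_def simps)
  then have T: "T = 0 \<or> T = 1"
    by (simp add: power2_eq_square)
  have f_2i: "f ^ 2 ^ (2 * i) = (f ^ 2 ^ i) ^ 2 ^ i"
    by (simp add: mult_2 power_add power_mult)
  have "h ^ 8 = h \<and>
    (f + (s ^ 2 ^ i * h + s * h ^ 2 ^ i)) ^ 2 + (f + (s ^ 2 ^ i * h + s * h ^ 2 ^ i)) ^ 4 = h"
    using assms(4)
  proof (cases rule: frobenius_cases_8[where 'a = 'a])
    case 1
    have f2: "(f ^ 2) ^ 8 = f ^ 2"
      by (simp add: simps)
    have "f ^ 2 ^ (2 * i) = f ^ 4"
      unfolding f_2i 1[OF f] 1[OF f2] by (simp flip: power_mult)
    then have h: "h = (if T = 0 then f ^ 2 + f ^ 4 else f + f ^ 2)"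
      using T by (auto simp: h_def simps)
    \<comment> \<open>In both cases \<open>h\<close> has the form \<open>y + y ^ 2\<close> with
      \<open>y ^ 8 = y\<close>, so its trace \<open>h + h ^ 2 + h ^ 4\<close> vanishes.\<close>
    have h3: "h + h ^ 2 = h ^ 4"
      by (simp add: h simps)
    have h8: "h ^ 8 = h"
      by (simp add: h simps)
    have "(s ^ 2 * h + s * h ^ 2) ^ 2 + (s ^ 2 * h + s * h ^ 2) ^ 4
      = s ^ 4 * (h + h ^ 2) + (s + s ^ 2) * h ^ 4"
      using h8 by (simp add: simps distrib_left distrib_right)
    also have "\<dots> = T * h ^ 4"
      unfolding h3 T_def by (simp add: algebra_simps)
    finally have "(s ^ 2 * h + s * h ^ 2) ^ 2 + (s ^ 2 * h + s * h ^ 2) ^ 4 = T * h ^ 4" .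
    moreover have "f ^ 2 + f ^ 4 + T * h ^ 4 = h"
      using T by (auto simp: h simps)
    ultimately show ?thesis
      using h8 1 s by (simp add: p2 [of f] p4 [of f] add_ac)
  next
    case 2
    have f4: "(f ^ 4) ^ 8 = f ^ 4"
      using power_mult[of f 8 4] by (simp add: f flip: power_mult)
    have "f ^ 2 ^ (2 * i) = f ^ 2"
      unfolding f_2i 2[OF f] 2[OF f4] by (simp add: f16 flip: power_mult)
    then have h: "h = (if T = 0 then f ^ 2 + f ^ 4 else f + f ^ 4)"
      using T by (auto simp: h_def simps)
    \<comment> \<open>Trace zero again: \<open>f + f ^ 4\<close> is \<open>y + y ^ 2\<close> for
      \<open>y = f ^ 4\<close>.\<close>
    have h3: "h + h ^ 4 = h ^ 2"
      by (simp add: h simps)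
    have h8: "h ^ 8 = h"
      by (simp add: h simps)
    have "(s ^ 4 * h + s * h ^ 4) ^ 2 + (s ^ 4 * h + s * h ^ 4) ^ 4
      = (s + s ^ 4) * h ^ 2 + s ^ 2 * (h + h ^ 4)"
      using h8 power_mult[of h 8 2] by (simp add: simps distrib_left distrib_right)
    also have "\<dots> = T * h ^ 2"
      unfolding h3 T_def by (simp add: algebra_simps)
    finally have "(s ^ 4 * h + s * h ^ 4) ^ 2 + (s ^ 4 * h + s * h ^ 4) ^ 4 = T * h ^ 2" .
    moreover have "f ^ 2 + f ^ 4 + T * h ^ 2 = h"
      using T by (auto simp: h simps)
    ultimately show ?thesis
      using h8 2 s by (simp add: p2 [of f] p4 [of f] add_ac)
  qed
  then show "h ^ 8 = h"
    and "(f + (s ^ 2 ^ i * h + s * h ^ 2 ^ i)) ^ 2 + (f + (s ^ 2 ^ i * h + s * h ^ 2 ^ i)) ^ 4 = h"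
    by blast+
qed

text \<open>The correction \<open>h = u - x\<close> lies in the subfield with 8 elements, so the
  trace of \<open>F (x + h)\<close> depends only on \<open>h\<close> and the traces of
  \<open>x\<close> and \<open>F x\<close>.\<close>

lemma inverse_identity:
  fixes x :: "'a::field"
  assumes two: "(2 :: 'a) = 0" and m: "6 dvd m" and i: "\<not> 3 dvd i" and x: "x ^ 2 ^ m = x"
  defines "u \<equiv> x + rel_trace3 m (x ^ (2 * (2 ^ i + 1)) + x ^ (4 * (2 ^ i + 1)))
       + abs_trace m x * rel_trace3 m (x ^ (2 ^ i + 1) + x ^ (2 ^ (2 * i) * (2 ^ i + 1)))"
  shows "u + rel_trace3 m ((u ^ (2 ^ i + 1)) ^ 2 + (u ^ (2 ^ i + 1)) ^ 4) = x"
proof -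
  have m3: "3 dvd m"
    using m by presburger
  let ?t = "rel_trace3 m :: 'a \<Rightarrow> 'a"
  define F where "F y = y ^ (2 ^ i + 1)" for y :: 'a
  define f s where "f = ?t (F x)" and "s = ?t x"
  define h where "h = f ^ 2 + f ^ 4 + (s + s ^ 2 + s ^ 4) * (f + f ^ 2 ^ (2 * i))"
  have t_sq: "?t (y ^ 2) = ?t y ^ 2" and t_4: "?t (y ^ 4) = ?t y ^ 4" for y
    using rel_trace3_frobenius[OF two, of m y 1] rel_trace3_frobenius[OF two, of m y 2] by simp_all
  have pw: "y ^ (k * (2 ^ i + 1)) = F y ^ k" for k y
    unfolding F_def by (metis mult.commute power_mult)
  have Fx: "F x ^ 2 ^ m = F x"
    unfolding F_def by (metis mult.commute power_mult x)
  have f8: "f ^ 8 = f" and s8: "s ^ 8 = s"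
    unfolding f_def s_def using rel_trace3_power_8[OF two m3] x Fx by blast+
  have h8: "h ^ 8 = h" and
    h: "(f + (s ^ 2 ^ i * h + s * h ^ 2 ^ i)) ^ 2 + (f + (s ^ 2 ^ i * h + s * h ^ 2 ^ i)) ^ 4 = h"
    unfolding h_def using inverse_identity_8[OF two f8 s8 i] by auto
  have u: "u = x + h"
    unfolding u_def pw rel_trace3_add[OF two] t_sq t_4 rel_trace3_frobenius[OF two]
      abs_trace_eq_rel_trace3[OF two m3]
    by (simp add: h_def f_def s_def F_def add.assoc)
  have pow8: "(h ^ k) ^ 8 = h ^ k" for k
    by (metis h8 mult.commute power_mult)
  have "?t (F u) = f + ?t (h * x ^ 2 ^ i) + ?t (h ^ 2 ^ i * x) + ?t (h ^ (2 ^ i + 1))"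
    unfolding u F_def gold_add[OF two] rel_trace3_add[OF two] f_def by (simp only: mult.commute)
  \<comment> \<open>Powers of \<open>h\<close> factor out of the mixed terms, and the trace of
    \<open>F h\<close>, an element of the subfield, is zero.\<close>
  also have "\<dots> = f + (s ^ 2 ^ i * h + s * h ^ 2 ^ i)"
    unfolding rel_trace3_fixed[OF two m pow8] rel_trace3_mult[OF h8] rel_trace3_mult[OF pow8]
      rel_trace3_frobenius[OF two] s_def by (simp add: mult.commute add.assoc)
  finally have "?t (F u ^ 2 + F u ^ 4) = h"
    unfolding rel_trace3_add[OF two] t_sq t_4 using h by simp
  then show ?thesis
    unfolding F_def u by (simp add: add.assoc add_self[OF two])
qed

section \<open>Transfer of the APN property along the graph transformation\<close>

theorem theorem3:
  fixes m i :: nat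
  assumes "m > 0" and "6 dvd m" and "i > 0" and "gcd m i = 1"
    and "CARD('a) = 2 ^ m"
  shows "APN (F' m i :: 'a::{field,finite} \<Rightarrow> 'a)"
proof -
  note two = two_eq_0[OF assms(5)]
  have i3: "\<not> 3 dvd i"
  proof
    assume "3 dvd i"
    moreover have "3 dvd m"
      using assms(2) by presburger
    ultimately have "3 dvd gcd m i"
      by simp
    then show False
      using assms(4) by simp
  qed
  define F where "F y = y ^ (2 ^ i + 1)" for y :: 'a
  define T where "T y = rel_trace3 m (y ^ 2 + y ^ 4)" for y :: 'a
  define G where "G x = x + rel_trace3 m (x ^ (2 * (2 ^ i + 1)) + x ^ (4 * (2 ^ i + 1)))
       + abs_trace m x * rel_trace3 m (x ^ (2 ^ i + 1) + x ^ (2 ^ (2 * i) * (2 ^ i + 1)))" for x :: 'a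
  have F': "F' m i x = F (G x)" for x
    by (simp add: F'_def F_def G_def)
  have G: "G x + T (F (G x)) = x" for x
    unfolding G_def T_def F_def
    using inverse_identity[OF two assms(2) i3, of x] power_card_eq_self[of x] assms(5) by simp
  have T_add: "T (y + z) = T y + T z" for y z
    using frobenius_add[OF two, of y z 1] frobenius_add[OF two, of y z 2]
    by (simp add: T_def rel_trace3_add[OF two])
  have "card {x. F' m i (x + a) + F' m i x = b} \<le> 2" if a: "a \<noteq> 0" for a b :: 'a
  proof -
    define S where "S = {x. F' m i (x + a) + F' m i x = b}"
    \<comment> \<open>The involution \<open>(x, y) \<mapsto> (x + T y, y)\<close> sends the
      difference \<open>(a, b)\<close> of two graph points to \<open>(c, b)\<close>.\<close>
    define c where "c = a + T b"
    have eq: "G (x + a) = G x + c \<and> F (G x) + F (G x + c) = b" if "x \<in> S" for x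
    proof -
      have b: "b = F (G x) + F (G (x + a))"
        using that by (simp add: S_def F' add.commute)
      have "G x + G (x + a) + T b = (G x + T (F (G x))) + (G (x + a) + T (F (G (x + a))))"
        by (simp add: b T_add ac_simps)
      also have "\<dots> = x + (x + a)"
        by (simp only: G)
      finally have "G x + G (x + a) + T b = a"
        by (simp add: add_cancel_left[OF two])
      then have "G (x + a) = G x + c"
        unfolding c_def by (metis add.assoc add.commute add_cancel_left[OF two])
      then show ?thesis
        using b by simp
    qed
    show ?thesis
    proof (cases "S = {}")
      case True
      then show ?thesis
        by (simp add: S_def)
    next
      case False
      then obtain x where x: "x \<in> S"
        by blast
      \<comment> \<open>The involution has trivial kernel: \<open>c = 0\<close> forces
        \<open>b = 0\<close>, hence \<open>a = 0\<close>.\<close>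
      have "c \<noteq> 0"
      proof
        assume c: "c = 0"
        then have "b = 0"
          using eq[OF x] by (simp add: add_self[OF two])
        then have "T b = 0"
          using T_add[of 0 0] by (metis add_0 add_cancel_right_right)
        then show False
          using a c by (simp add: c_def)
      qed
      have "G y \<in> {G x, G x + c}" if "y \<in> S" for y
        using gold_APN[OF assms(4,3,5) \<open>c \<noteq> 0\<close>, of "G x" "G y"] eq[OF x] eq[OF that]
        by (auto simp: F_def)
      then have "card (G ` S) \<le> card {G x, G x + c}"
        by (intro card_mono) auto
      also have "\<dots> \<le> 2"
        by (simp add: card_insert_if)
      finally have "card (G ` S) \<le> 2" .
      \<comment> \<open>The identity \<open>G\<close> exhibits a left inverse, so the bound on the
        image of \<open>S\<close> is a bound on \<open>S\<close>.\<close>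
      moreover have "inj G"
        by (metis G injI)
      ultimately show ?thesis
        unfolding S_def by (simp add: card_image inj_on_subset)
    qed
  qed
  then show ?thesis
    by (simp add: APN_def)
qed

end
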